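(* It is not possible to code an infinite linear ordering in $\mathcal{E}$ without parameters, even on equivalence classes of tuples: there are no $n\ge1$ and parameter-free first-order formulas $\delta(\bar x)$, $\varepsilon(\bar x,\bar y)$, $\lambda(\bar x,\bar y)$ in the language of $\mathcal{E}$ (with $\bar x,\bar y$ $n$-tuples of variables) such that $\varepsilon$ defines an equivalence relation on $D=\{\bar X\in\mathcal{E}^n:\mathcal{E}\models\delta(\bar X)\}$, $\lambda$ defines on $D$ a relation compatible with this equivalence, and the induced structure on the quotient of $D$ is an infinite linear order.
   Context: $\mathcal{E}$ is the lattice of c.e. subsets of $\mathbb{N}$ under inclusion. *)

theory Defs
  imports Main
begin

section \<open>Computably enumerable sets\<close>

text \<open>
  Programs for the partial recursive functions. Arities are not part of the syntax: a program is
  run on an argument list of any length, and it diverges on arguments that do not fit.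
\<close>

datatype recf =
    Zero
  | Succ
  | Proj nat
  | Comp recf "recf list"
  | PrimRec recf recf
  | Mu recf

inductive converges :: "recf \<Rightarrow> nat list \<Rightarrow> nat \<Rightarrow> bool" where
  zero: "converges Zero xs 0"
| succ: "converges Succ [x] (Suc x)"
| proj: "i < length xs \<Longrightarrow> converges (Proj i) xs (xs ! i)"
| comp: "list_all2 (\<lambda>g y. converges g xs y) gs ys \<Longrightarrow> converges f ys z
    \<Longrightarrow> converges (Comp f gs) xs z"
| primrec_0: "converges f xs y \<Longrightarrow> converges (PrimRec f g) (0 # xs) y"
| primrec_Suc: "converges (PrimRec f g) (k # xs) r \<Longrightarrow> converges g (k # r # xs) y
    \<Longrightarrow> converges (PrimRec f g) (Suc k # xs) y"
| mu: "converges f (k # xs) 0 \<Longrightarrow> (\<And>m. m < k \<Longrightarrow> \<exists>r. converges f (m # xs) (Suc r))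
    \<Longrightarrow> converges (Mu f) xs k"

text \<open>A set is c.e. iff it is the domain of a unary partial recursive function.\<close>

definition ce :: "nat set \<Rightarrow> bool" where
  "ce A \<longleftrightarrow> (\<exists>f. A = {x. \<exists>y. converges f [x] y})"

definition CE :: "nat set set" where
  "CE = {A. ce A}"


section \<open>First-order formulas in the language of CE\<close>

text \<open>
  The language has equality and one binary relation symbol, for inclusion; the lattice operations
  are definable from it. Variables are named by natural numbers. The formulas contain no constants
  for elements of the structure, so those whose free variables are all among the variables of the
  tuples considered are exactly the parameter-free ones.
\<close>

datatype fm =
    Eq nat nat
  | Le nat nat
  | Neg fm
  | Conj fm fm
  | Ex nat fm

primrec fv :: "fm \<Rightarrow> nat set" where
  "fv (Eq i j) = {i, j}"
| "fv (Le i j) = {i, j}"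
| "fv (Neg p) = fv p"
| "fv (Conj p q) = fv p \<union> fv q"
| "fv (Ex i p) = fv p - {i}"

primrec sat :: "(nat \<Rightarrow> nat set) \<Rightarrow> fm \<Rightarrow> bool" where
  "sat s (Eq i j) \<longleftrightarrow> s i = s j"
| "sat s (Le i j) \<longleftrightarrow> s i \<subseteq> s j"
| "sat s (Neg p) \<longleftrightarrow> \<not> sat s p"
| "sat s (Conj p q) \<longleftrightarrow> sat s p \<and> sat s q"
| "sat s (Ex i p) \<longleftrightarrow> (\<exists>A\<in>CE. sat (s(i := A)) p)"


section \<open>Definable sets and relations of tuples\<close>

definition tuples :: "nat \<Rightarrow> nat set list set" where
  "tuples n = {X. length X = n \<and> set X \<subseteq> CE}"

text \<open>
  An \<open>n\<close>-tuple interprets the variables \<open>0, \<dots>, n - 1\<close>; for binary relations, the second tuple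
  interprets \<open>n, \<dots>, 2 n - 1\<close>. The values of the assignments beyond the length of the list are
  irrelevant for formulas whose free variables are restricted accordingly.
\<close>

definition def_set :: "nat \<Rightarrow> fm \<Rightarrow> nat set list set" where
  "def_set n p = {X \<in> tuples n. sat (\<lambda>i. X ! i) p}"

definition def_rel :: "nat set list set \<Rightarrow> fm \<Rightarrow> (nat set list \<times> nat set list) set" where
  "def_rel D p = {(X, Y) \<in> D \<times> D. sat (\<lambda>i. (X @ Y) ! i) p}"

definition quotient_rel :: "('a \<times> 'a) set \<Rightarrow> ('a \<times> 'a) set \<Rightarrow> ('a set \<times> 'a set) set" where
  "quotient_rel E R = {(E `` {x}, E `` {y}) |x y. (x, y) \<in> R}"

text \<open>The order on the quotient may be given as a reflexive or as a strict linear order.\<close>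

definition codes_infinite_linear_order :: "nat \<Rightarrow> fm \<Rightarrow> fm \<Rightarrow> fm \<Rightarrow> bool" where
  "codes_infinite_linear_order n p q r \<longleftrightarrow>
    (let D = def_set n p; E = def_rel D q; R = def_rel D r
     in equiv D E \<and>
        (\<lambda>X Y. (X, Y) \<in> R) respects2 E \<and>
        infinite (D // E) \<and>
        (linear_order_on (D // E) (quotient_rel E R) \<or>
         strict_linear_order_on (D // E) (quotient_rel E R)))"

end

(* Splitting into even and odd parts identifies CE with CE x CE, and exchanging the two factors is an
   automorphism. By a Feferman-Vaught argument the truth of a formula at a joined assignment
   depends only on the truth values of finitely many formulas at the two components.

   In a linear order, X and Y are equal as soon as (X, Y) and (Y, X) have the same type. Hence the
   joins of U, V and of V, U always lie in the same class. If there were infinitely many classes,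
   then, for some fixed U, infinitely many of them would contain a join of U with some V (after
   exchanging the two factors if necessary). Two of these, given by V and V', agree on the types of
   the pairs (U, V), (U, V'). Comparing the join of U, V with the join of V', U then shows that the
   two classes are equal. *)

theory Submission
  imports Defs
begin

section \<open>Even and odd parts of c.e. sets\<close>

text \<open>The disjoint sum \<open>U \<oplus> V\<close> of computability theory;
  \<open>evens\<close> and \<open>odds\<close> are its two projections.\<close>

definition join :: "nat set \<Rightarrow> nat set \<Rightarrow> nat set" where
  "join U V = {x. x div 2 \<in> (if even x then U else V)}"

definition evens :: "nat set \<Rightarrow> nat set" where
  "evens A = {x. 2 * x \<in> A}"

definition odds :: "nat set \<Rightarrow> nat set" where
  "odds A = {x. Suc (2 * x) \<in> A}"

lemma evens_join [simp]: "evens (join U V) = U"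
  by (simp add: evens_def join_def)

lemma odds_join [simp]: "odds (join U V) = V"
  by (simp add: odds_def join_def)

lemma join_evens_odds [simp]: "join (evens A) (odds A) = A"
  by (auto simp: evens_def odds_def join_def)

lemma join_eq_iff: "join U V = join U' V' \<longleftrightarrow> U = U' \<and> V = V'"
  by (metis evens_join odds_join)

text \<open>Even and odd members are compared separately. With the closure properties of
  \<open>CE\<close> below, this makes \<open>join\<close> a lattice isomorphism from the square of
  \<open>CE\<close> onto \<open>CE\<close>.\<close>

lemma join_subset_iff: "join U V \<subseteq> join U' V' \<longleftrightarrow> U \<subseteq> U' \<and> V \<subseteq> V'"
proof
  assume sub: "join U V \<subseteq> join U' V'"
  have "evens (join U V) \<subseteq> evens (join U' V')" "odds (join U V) \<subseteq> odds (join U' V')"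
    using sub by (auto simp: evens_def odds_def)
  then show "U \<subseteq> U' \<and> V \<subseteq> V'" by simp
qed (auto simp: join_def split: if_splits)

section \<open>Programs for parity, halving and doubling\<close>

lemma converges_Zero_iff: "converges Zero xs y \<longleftrightarrow> y = 0"
  by (auto elim: converges.cases intro: converges.intros)

lemma converges_Succ_iff: "converges Succ [x] y \<longleftrightarrow> y = Suc x"
  by (auto elim: converges.cases intro: converges.intros)

lemma converges_Proj_iff: "converges (Proj i) xs y \<longleftrightarrow> i < length xs \<and> y = xs ! i"
  by (auto elim: converges.cases intro: converges.intros)

lemma converges_Comp_iff:
  "converges (Comp f gs) xs z \<longleftrightarrow>
    (\<exists>ys. list_all2 (\<lambda>g y. converges g xs y) gs ys \<and> converges f ys z)"
  by (auto elim: converges.cases intro: converges.intros)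

lemma converges_PrimRec_0_iff: "converges (PrimRec f g) (0 # xs) y \<longleftrightarrow> converges f xs y"
  by (auto elim: converges.cases intro: converges.intros)

lemma converges_PrimRec_Suc_iff:
  "converges (PrimRec f g) (Suc k # xs) y \<longleftrightarrow>
    (\<exists>r. converges (PrimRec f g) (k # xs) r \<and> converges g (k # r # xs) y)"
  by (auto elim: converges.cases intro: converges.intros)

lemmas converges_iffs =
  converges_Zero_iff converges_Succ_iff converges_Proj_iff converges_Comp_iff
  converges_PrimRec_0_iff converges_PrimRec_Suc_iff list_all2_Cons1

definition add_prog :: recf where
  "add_prog = PrimRec (Proj 0) (Comp Succ [Proj 1])"

text \<open>The recursion has no parameters, so the base case is the constant 1 on the empty
  argument list.\<close>

definition not_prog :: recf where
  "not_prog = PrimRec (Comp Succ [Zero]) Zero"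

definition parity_prog :: recf where
  "parity_prog = PrimRec Zero (Comp not_prog [Proj 1])"

text \<open>Recursion along \<open>Suc k div 2 = k mod 2 + k div 2\<close>: in the step,
  \<open>Proj 0\<close> is the counter \<open>k\<close> and \<open>Proj 1\<close> the previous
  value.\<close>

definition half_prog :: recf where
  "half_prog = PrimRec Zero (Comp add_prog [Comp parity_prog [Proj 0], Proj 1])"

definition double_prog :: recf where
  "double_prog = Comp add_prog [Proj 0, Proj 0]"

lemma converges_add_prog: "converges add_prog [x, y] z \<longleftrightarrow> z = x + y"
  unfolding add_prog_def by (induction x arbitrary: z) (auto simp: converges_iffs)

lemma converges_not_prog: "converges not_prog [x] z \<longleftrightarrow> z = (if x = 0 then 1 else 0)"
  unfolding not_prog_def by (induction x arbitrary: z) (auto simp: converges_iffs)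

lemma converges_parity_prog: "converges parity_prog [x] z \<longleftrightarrow> z = x mod 2"
  unfolding parity_prog_def
  by (induction x arbitrary: z) (auto simp: converges_iffs converges_not_prog mod_Suc)

lemma converges_half_prog: "converges half_prog [x] z \<longleftrightarrow> z = x div 2"
proof (induction x arbitrary: z)
  case 0
  then show ?case by (simp add: half_prog_def converges_iffs)
next
  case (Suc x)
  have "x mod 2 + x div 2 = Suc x div 2" by presburger
  with Suc show ?case
    by (simp add: half_prog_def converges_iffs converges_add_prog converges_parity_prog)
qed

lemma converges_double_prog: "converges double_prog [x] z \<longleftrightarrow> z = 2 * x"
  unfolding double_prog_def by (auto simp: converges_iffs converges_add_prog)

section \<open>Closure of \<open>CE\<close> under halves and joins\<close>

lemma CE_evens:
  assumes "A \<in> CE" shows "evens A \<in> CE"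
proof -
  obtain f where f: "A = {x. \<exists>y. converges f [x] y}" using assms by (auto simp: CE_def ce_def)
  have "evens A = {x. \<exists>y. converges (Comp f [double_prog]) [x] y}"
    by (auto simp: f evens_def converges_iffs converges_double_prog)
  then show ?thesis by (auto simp: CE_def ce_def)
qed

lemma CE_odds:
  assumes "A \<in> CE" shows "odds A \<in> CE"
proof -
  obtain f where f: "A = {x. \<exists>y. converges f [x] y}" using assms by (auto simp: CE_def ce_def)
  have "odds A = {x. \<exists>y. converges (Comp f [Comp Succ [double_prog]]) [x] y}"
    by (auto simp: f odds_def converges_iffs converges_double_prog)
  then show ?thesis by (auto simp: CE_def ce_def)
qed

text \<open>A loop that is executed \<open>b\<close> times is a conditional that does not run \<open>f\<close> if \<open>b = 0\<close>.\<close>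

definition guard_prog :: "recf \<Rightarrow> recf" where
  "guard_prog f = PrimRec Zero (Comp f [Proj 2])"

text \<open>All rounds run \<open>f\<close> on the same argument \<open>x\<close>, so for positive
  \<open>b\<close> they all converge as soon as one of them does.\<close>

lemma converges_guard_prog:
  "(\<exists>y. converges (guard_prog f) [b, x] y) \<longleftrightarrow> b = 0 \<or> (\<exists>y. converges f [x] y)"
  unfolding guard_prog_def by (induction b) (auto simp: converges_iffs)

lemma CE_join:
  assumes "U \<in> CE" "V \<in> CE" shows "join U V \<in> CE"
proof -
  obtain f where f: "U = {x. \<exists>y. converges f [x] y}" using assms by (auto simp: CE_def ce_def)
  obtain g where g: "V = {x. \<exists>y. converges g [x] y}" using assms by (auto simp: CE_def ce_def)
  \<comment> \<open>\<open>Comp\<close> needs all its arguments to converge and so acts as a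
    conjunction. The guards are \<open>1 - x mod 2\<close> and \<open>x mod 2\<close>: just one of
    \<open>f\<close> and \<open>g\<close> is really run, on \<open>x div 2\<close>.\<close>
  define h where "h = Comp Zero
    [Comp (guard_prog f) [Comp not_prog [parity_prog], half_prog],
     Comp (guard_prog g) [parity_prog, half_prog]]"
  have "(\<exists>y. converges h [x] y) \<longleftrightarrow>
      (\<exists>y. converges (guard_prog f) [if x mod 2 = 0 then 1 else 0, x div 2] y) \<and>
      (\<exists>y. converges (guard_prog g) [x mod 2, x div 2] y)" for x
    unfolding h_def
    by (auto simp: converges_iffs converges_not_prog converges_parity_prog converges_half_prog)
  then have "join U V = {x. \<exists>y. converges h [x] y}"
    unfolding converges_guard_prog by (auto simp: f g join_def even_iff_mod_2_eq_zero)
  then show ?thesis by (auto simp: CE_def ce_def)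
qed

text \<open>Each c.e. set is the join of its halves, so a quantifier over \<open>CE\<close> splits
  into one quantifier per factor. This drives the \<open>Ex\<close> cases below.\<close>

lemma Bex_CE_join: "(\<exists>A\<in>CE. P A) \<longleftrightarrow> (\<exists>U\<in>CE. \<exists>V\<in>CE. P (join U V))"
  by (metis CE_evens CE_odds CE_join join_evens_odds)


section \<open>Formulas and joins of assignments\<close>

lemma sat_cong:
  assumes "\<And>i. i \<in> fv p \<Longrightarrow> s i = t i"
  shows "sat s p = sat t p"
  using assms
proof (induction p arbitrary: s t)
  case (Neg p)
  have "sat s p = sat t p" by (rule Neg.IH) (use Neg.prems in simp)
  then show ?case by simp
next
  case (Conj p q)
  have "sat s p = sat t p" by (rule Conj.IH) (use Conj.prems in simp)
  moreover have "sat s q = sat t q" by (rule Conj.IH) (use Conj.prems in simp)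
  ultimately show ?case by simp
next
  case (Ex i p)
  have "sat (s(i := A)) p = sat (t(i := A)) p" for A
    by (rule Ex.IH) (use Ex.prems in auto)
  then show ?case by simp
qed simp_all

abbreviation joins :: "(nat \<Rightarrow> nat set) \<Rightarrow> (nat \<Rightarrow> nat set) \<Rightarrow> nat \<Rightarrow> nat set" where
  "joins s t \<equiv> (\<lambda>i. join (s i) (t i))"

lemma joins_upd: "(joins s t)(i := join U V) = joins (s(i := U)) (t(i := V))"
  by (simp add: fun_eq_iff)

lemma sat_joins_Ex:
  "sat (joins s t) (Ex i p) \<longleftrightarrow> (\<exists>U\<in>CE. \<exists>V\<in>CE. sat (joins (s(i := U)) (t(i := V))) p)"
  unfolding sat.simps by (subst Bex_CE_join) (simp only: joins_upd)

text \<open>Exchanging the two factors is an automorphism; in the \<open>Ex\<close> case the two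
  halves of the witness trade places.\<close>

lemma sat_joins_commute: "sat (joins s t) p = sat (joins t s) p"
proof (induction p arbitrary: s t)
  case (Ex i p)
  then show ?case unfolding sat_joins_Ex by blast
next
  case (Conj p q)
  then show ?case unfolding sat.simps by blast
next
  case (Neg p)
  then show ?case unfolding sat.simps by blast
qed (auto simp: join_eq_iff join_subset_iff)

section \<open>Finite types and a Feferman-Vaught theorem for joins\<close>

lemma ex_fm_type:
  assumes "finite \<Phi>"
  shows "\<exists>\<psi>. \<forall>s. sat s \<psi> \<longleftrightarrow> {q \<in> \<Phi>. sat s q} = S \<inter> \<Phi>"
  using assms
proof induction
  case empty
  show ?case by (rule exI[of _ "Eq 0 0"]) simp
next
  case (insert q \<Phi>)
  then obtain \<psi> where \<psi>: "\<And>s. sat s \<psi> \<longleftrightarrow> {q \<in> \<Phi>. sat s q} = S \<inter> \<Phi>" by blast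
  \<comment> \<open>Each member of the finite set enters as it is or negated, according to
    \<open>S\<close>, so that the conjunction isolates a single type.\<close>
  have "sat s (Conj \<psi> (if q \<in> S then q else Neg q)) \<longleftrightarrow>
      {r \<in> insert q \<Phi>. sat s r} = S \<inter> insert q \<Phi>" for s
    using insert.hyps by (auto simp: \<psi> set_eq_iff)
  then show ?case by blast
qed

definition agree :: "fm set \<Rightarrow> (nat \<Rightarrow> nat set) \<Rightarrow> (nat \<Rightarrow> nat set) \<Rightarrow> bool" where
  "agree \<Phi> s t \<longleftrightarrow> (\<forall>q\<in>\<Phi>. sat s q = sat t q)"

text \<open>One back-and-forth step: \<open>\<Psi>\<close> says, for each of the finitely many types
  over \<open>\<Phi>\<close>, whether some c.e. value of variable \<open>i\<close> realizes
  it.\<close>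

lemma ex_agree_step:
  assumes "finite \<Phi>"
  shows "\<exists>\<Psi>. finite \<Psi> \<and> (\<forall>s t. agree \<Psi> s t \<longrightarrow>
    (\<forall>A\<in>CE. \<exists>B\<in>CE. agree \<Phi> (s(i := A)) (t(i := B))))"
proof -
  have "\<forall>S. \<exists>\<psi>. \<forall>s. sat s \<psi> \<longleftrightarrow> {q \<in> \<Phi>. sat s q} = S \<inter> \<Phi>"
    using ex_fm_type[OF assms] by blast
  then obtain \<psi> where \<psi>: "\<And>S s. sat s (\<psi> S) \<longleftrightarrow> {q \<in> \<Phi>. sat s q} = S \<inter> \<Phi>" by metis
  have "\<exists>B\<in>CE. agree \<Phi> (s(i := A)) (t(i := B))"
    if agr: "agree ((\<lambda>S. Ex i (\<psi> S)) ` Pow \<Phi>) s t" and A: "A \<in> CE" for s t A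
  proof -
    define S where "S = {q \<in> \<Phi>. sat (s(i := A)) q}"
    have "sat s (Ex i (\<psi> S))" using A by (auto simp: \<psi> S_def)
    moreover have "S \<in> Pow \<Phi>" by (auto simp: S_def)
    ultimately have "sat t (Ex i (\<psi> S))" using agr by (auto simp: agree_def)
    then obtain B where "B \<in> CE" "{q \<in> \<Phi>. sat (t(i := B)) q} = S \<inter> \<Phi>" by (auto simp: \<psi>)
    then show ?thesis by (auto simp: agree_def S_def)
  qed
  with assms show ?thesis by (intro exI[of _ "(\<lambda>S. Ex i (\<psi> S)) ` Pow \<Phi>"]) simp
qed

text \<open>Induction on \<open>p\<close>. For \<open>Ex\<close>, the two halves of a witness are
  transferred separately by \<open>ex_agree_step\<close>, each within its own factor.\<close>

theorem Feferman_Vaught_joins: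
  "\<exists>\<Phi>. finite \<Phi> \<and> (\<forall>s s' t t'. agree \<Phi> s s' \<longrightarrow> agree \<Phi> t t' \<longrightarrow>
    sat (joins s t) p = sat (joins s' t') p)"
proof (induction p)
  case (Eq i j)
  show ?case by (rule exI[of _ "{Eq i j}"]) (simp add: agree_def join_eq_iff)
next
  case (Le i j)
  show ?case by (rule exI[of _ "{Le i j}"]) (simp add: agree_def join_subset_iff)
next
  case (Neg p)
  then show ?case by simp
next
  case (Conj p q)
  from Conj.IH(1) obtain \<Phi> where \<Phi>: "finite \<Phi>"
    "\<And>s s' t t'. agree \<Phi> s s' \<Longrightarrow> agree \<Phi> t t' \<Longrightarrow> sat (joins s t) p = sat (joins s' t') p"
    by blast
  from Conj.IH(2) obtain \<Psi> where \<Psi>: "finite \<Psi>"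
    "\<And>s s' t t'. agree \<Psi> s s' \<Longrightarrow> agree \<Psi> t t' \<Longrightarrow> sat (joins s t) q = sat (joins s' t') q"
    by blast
  have "sat (joins s t) (Conj p q) = sat (joins s' t') (Conj p q)"
    if "agree (\<Phi> \<union> \<Psi>) s s'" "agree (\<Phi> \<union> \<Psi>) t t'" for s s' t t'
  proof -
    have "agree \<Phi> s s'" "agree \<Phi> t t'" "agree \<Psi> s s'" "agree \<Psi> t t'"
      using that by (auto simp: agree_def)
    then show ?thesis using \<Phi>(2) \<Psi>(2) by simp
  qed
  with \<Phi>(1) \<Psi>(1) show ?case by (intro exI[of _ "\<Phi> \<union> \<Psi>"]) blast
next
  case (Ex i p)
  then obtain \<Phi> where "finite \<Phi>" and
    \<Phi>: "\<And>s s' t t'. agree \<Phi> s s' \<Longrightarrow> agree \<Phi> t t' \<Longrightarrow> sat (joins s t) p = sat (joins s' t') p"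
    by blast
  obtain \<Psi> where "finite \<Psi>" and
    "\<forall>s t. agree \<Psi> s t \<longrightarrow> (\<forall>A\<in>CE. \<exists>B\<in>CE. agree \<Phi> (s(i := A)) (t(i := B)))"
    using ex_agree_step[OF \<open>finite \<Phi>\<close>, of i] by (elim exE conjE) (rule that)
  then have \<Psi>: "\<exists>B\<in>CE. agree \<Phi> (s(i := A)) (t(i := B))" if "agree \<Psi> s t" "A \<in> CE" for s t A
    using that by simp
  have imp: "sat (joins s' t') (Ex i p)"
    if st: "agree \<Psi> s s'" "agree \<Psi> t t'" and sat: "sat (joins s t) (Ex i p)" for s s' t t'
  proof -
    obtain U V where UV: "U \<in> CE" "V \<in> CE" "sat (joins (s(i := U)) (t(i := V))) p"
      using sat unfolding sat_joins_Ex by blast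
    obtain U' where "U' \<in> CE" and U': "agree \<Phi> (s(i := U)) (s'(i := U'))"
      using \<Psi>[OF st(1) UV(1)] by (elim bexE) (rule that)
    obtain V' where "V' \<in> CE" and V': "agree \<Phi> (t(i := V)) (t'(i := V'))"
      using \<Psi>[OF st(2) UV(2)] by (elim bexE) (rule that)
    have "sat (joins (s'(i := U')) (t'(i := V'))) p" using \<Phi>[OF U' V'] UV(3) by (rule iffD1)
    with \<open>U' \<in> CE\<close> \<open>V' \<in> CE\<close> show ?thesis
      unfolding sat_joins_Ex by blast
  qed
  \<comment> \<open>Agreement is symmetric, so the implication \<open>imp\<close> already yields the
    equivalence.\<close>
  have "agree \<Psi> s t \<Longrightarrow> agree \<Psi> t s" for s t by (simp add: agree_def)
  with imp \<open>finite \<Psi>\<close> show ?case by (intro exI[of _ \<Psi>]) blast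
qed


section \<open>Tuples\<close>

abbreviation join_tuple :: "nat set list \<Rightarrow> nat set list \<Rightarrow> nat set list" where
  "join_tuple \<equiv> map2 join"

text \<open>The default \<open>{}\<close> replaces the unspecified values of \<open>!\<close> beyond
  the list. Since \<open>join {} {} = {}\<close>, joining commutes with \<open>env\<close> at every
  index.\<close>

definition env :: "nat set list \<Rightarrow> nat set list \<Rightarrow> nat \<Rightarrow> nat set" where
  "env X Y i = (if i < length (X @ Y) then (X @ Y) ! i else {})"

lemma join_tuple_in_tuples:
  assumes "U \<in> tuples n" "V \<in> tuples n"
  shows "join_tuple U V \<in> tuples n"
  using assms by (auto simp: tuples_def set_zip intro!: CE_join)

lemma ex_join_tuple:
  assumes "X \<in> tuples n"
  obtains U V where "U \<in> tuples n" "V \<in> tuples n" "X = join_tuple U V"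
proof
  show "map evens X \<in> tuples n" "map odds X \<in> tuples n"
    using assms by (auto simp: tuples_def intro: CE_evens CE_odds)
  show "X = join_tuple (map evens X) (map odds X)"
    by (simp add: list_eq_iff_nth_eq)
qed

lemma env_join_tuple:
  assumes "U \<in> tuples n" "V \<in> tuples n" "U' \<in> tuples n" "V' \<in> tuples n"
  shows "env (join_tuple U V) (join_tuple U' V') = joins (env U U') (env V V')"
proof -
  have "join {} {} = {}" by (simp add: join_def)
  then show ?thesis using assms by (auto simp: env_def tuples_def nth_append fun_eq_iff)
qed

text \<open>The second tuple is arbitrary because \<open>p\<close> mentions only the first
  \<open>n\<close> variables; thus \<open>\<delta>\<close> can be evaluated in the same environments
  as the formulas about pairs.\<close>

lemma def_set_iff_env:
  assumes "fv p \<subseteq> {..<n}"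
  shows "X \<in> def_set n p \<longleftrightarrow> X \<in> tuples n \<and> sat (env X Y) p"
proof -
  have "sat (\<lambda>i. X ! i) p = sat (env X Y) p" if "X \<in> tuples n"
    by (rule sat_cong) (use assms that in \<open>auto simp: env_def tuples_def nth_append\<close>)
  then show ?thesis by (auto simp: def_set_def)
qed

lemma def_rel_iff_env:
  assumes "fv p \<subseteq> {..<2 * n}" "X \<in> D" "Y \<in> D" "D \<subseteq> tuples n"
  shows "(X, Y) \<in> def_rel D p \<longleftrightarrow> sat (env X Y) p"
proof -
  have "sat (\<lambda>i. (X @ Y) ! i) p = sat (env X Y) p"
    by (rule sat_cong) (use assms in \<open>auto simp: env_def tuples_def subset_iff\<close>)
  with assms show ?thesis by (auto simp: def_rel_def)
qed

section \<open>Symmetric pairs in linear quotients, and a pigeonhole principle\<close>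

lemma eq_classes_if_symmetric:
  assumes "equiv D E" "(\<lambda>X Y. (X, Y) \<in> R) respects2 E"
    and "linear_order_on (D // E) (quotient_rel E R) \<or>
      strict_linear_order_on (D // E) (quotient_rel E R)"
    and XY: "X \<in> D" "Y \<in> D" "(X, Y) \<in> R \<longleftrightarrow> (Y, X) \<in> R"
  shows "(X, Y) \<in> E"
proof (rule ccontr)
  assume "(X, Y) \<notin> E"
  then have neq: "E `` {X} \<noteq> E `` {Y}" using assms(1) XY by (simp add: eq_equiv_class_iff)
  \<comment> \<open>Compatibility with \<open>E\<close> allows the quotient relation to be read off
    at any representatives.\<close>
  have in_iff: "(E `` {X}, E `` {Y}) \<in> quotient_rel E R \<longleftrightarrow> (X, Y) \<in> R"
    if "X \<in> D" "Y \<in> D" for X Y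
  proof
    assume "(E `` {X}, E `` {Y}) \<in> quotient_rel E R"
    then obtain x y where "E `` {X} = E `` {x}" "E `` {Y} = E `` {y}" "(x, y) \<in> R"
      by (auto simp: quotient_rel_def)
    moreover from this(1,2) have "(x, X) \<in> E" "(y, Y) \<in> E"
      using assms(1) that by (metis ImageI equiv_class_self Image_singleton_iff)+
    ultimately show "(X, Y) \<in> R" using congruent2D[OF assms(2)] by blast
  qed (auto simp: quotient_rel_def)
  have "E `` {X} \<in> D // E" "E `` {Y} \<in> D // E" using XY by (auto intro: quotientI)
  moreover have "total_on (D // E) (quotient_rel E R)"
    using assms(3) by (auto simp: linear_order_on_def strict_linear_order_on_def)
  \<comment> \<open>Totality relates distinct classes in one direction, and the symmetry hypothesis
    adds the other. Both orders forbid this: by antisymmetry, or by transitivity and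
    irreflexivity.\<close>
  ultimately have "(E `` {X}, E `` {Y}) \<in> quotient_rel E R \<or> (E `` {Y}, E `` {X}) \<in> quotient_rel E R"
    using neq by (simp add: total_on_def)
  with XY have both: "(E `` {X}, E `` {Y}) \<in> quotient_rel E R"
    "(E `` {Y}, E `` {X}) \<in> quotient_rel E R"
    by (simp_all add: in_iff)
  from assms(3) show False
  proof
    assume "linear_order_on (D // E) (quotient_rel E R)"
    then have "antisym (quotient_rel E R)"
      by (simp add: linear_order_on_def partial_order_on_def)
    with both neq show False by (metis antisymD)
  next
    assume "strict_linear_order_on (D // E) (quotient_rel E R)"
    then have "trans (quotient_rel E R)" "irrefl (quotient_rel E R)"
      by (simp_all add: strict_linear_order_on_def)
    with both show False by (metis transD irreflD)
  qed
qed

lemma infinite_image_same_type: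
  assumes "infinite (c ` S)" "finite (t ` S)"
  obtains x where "x \<in> S" "infinite (c ` {y \<in> S. t y = t x})"
proof -
  have "\<not> (\<forall>b\<in>t ` S. finite (c ` {y \<in> S. t y = b}))"
  proof
    assume "\<forall>b\<in>t ` S. finite (c ` {y \<in> S. t y = b})"
    then have "finite (\<Union>b\<in>t ` S. c ` {y \<in> S. t y = b})" using assms(2) by blast
    moreover have "c ` S \<subseteq> (\<Union>b\<in>t ` S. c ` {y \<in> S. t y = b})" by blast
    ultimately show False using assms(1) finite_subset by blast
  qed
  then show ?thesis using that by blast
qed

section \<open>Finiteness of the quotient of a definable set of tuples\<close>

theorem theorem4p24:
  shows "\<not> (\<exists>n \<delta> \<epsilon> \<rho>. n \<ge> 1 \<and>
    fv \<delta> \<subseteq> {..<n} \<and> fv \<epsilon> \<subseteq> {..<2 * n} \<and> fv \<rho> \<subseteq> {..<2 * n} \<and>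
    codes_infinite_linear_order n \<delta> \<epsilon> \<rho>)"
proof (intro notI, elim exE conjE)
  fix n \<delta> \<epsilon> \<rho>
  assume fv: "fv \<delta> \<subseteq> {..<n}" "fv \<epsilon> \<subseteq> {..<2 * n}" "fv \<rho> \<subseteq> {..<2 * n}"
    and codes: "codes_infinite_linear_order n \<delta> \<epsilon> \<rho>"
  define D where "D = def_set n \<delta>"
  define E where "E = def_rel D \<epsilon>"
  define R where "R = def_rel D \<rho>"
  have equiv: "equiv D E" and resp: "(\<lambda>X Y. (X, Y) \<in> R) respects2 E"
    and inf: "infinite (D // E)"
    and lin: "linear_order_on (D // E) (quotient_rel E R) \<or>
      strict_linear_order_on (D // E) (quotient_rel E R)"
    using codes by (simp_all add: codes_infinite_linear_order_def Let_def D_def E_def R_def)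
  have D_tuples: "D \<subseteq> tuples n" by (auto simp: D_def def_set_def)
  have D_iff: "X \<in> D \<longleftrightarrow> X \<in> tuples n \<and> sat (env X X) \<delta>" for X
    unfolding D_def by (rule def_set_iff_env[OF fv(1)])
  note E_iff = def_rel_iff_env[OF fv(2) _ _ D_tuples, folded E_def]
  note R_iff = def_rel_iff_env[OF fv(3) _ _ D_tuples, folded R_def]

  have "\<forall>p. \<exists>\<Phi>. finite \<Phi> \<and> (\<forall>s s' t t'. agree \<Phi> s s' \<longrightarrow> agree \<Phi> t t' \<longrightarrow>
      sat (joins s t) p = sat (joins s' t') p)"
    by (intro allI Feferman_Vaught_joins)
  from choice[OF this] obtain F where "\<forall>p. finite (F p) \<and>
      (\<forall>s s' t t'. agree (F p) s s' \<longrightarrow> agree (F p) t t' \<longrightarrow>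
        sat (joins s t) p = sat (joins s' t') p)"
    by (elim exE) (rule that)
  then have F: "\<And>p. finite (F p)"
    "\<And>p s s' t t'. agree (F p) s s' \<Longrightarrow> agree (F p) t t' \<Longrightarrow>
      sat (joins s t) p = sat (joins s' t') p"
    by simp_all
  \<comment> \<open>One finite set serves all three formulas, so a pair of tuples has only finitely
    many types \<open>tp\<close>.\<close>
  define \<Phi> where "\<Phi> = F \<delta> \<union> F \<epsilon> \<union> F \<rho>"
  define tp where "tp U V = {q \<in> \<Phi>. sat (env U V) q}" for U V
  have "finite \<Phi>" by (simp add: \<Phi>_def F)
  have finite_tp: "finite (range (\<lambda>x. (tp (f x) (g x), tp (h x) (k x))))"
    for f g h k :: "'a \<Rightarrow> nat set list"
    by (rule finite_subset[of _ "Pow \<Phi> \<times> Pow \<Phi>"]) (use \<open>finite \<Phi>\<close> in \<open>auto simp: tp_def\<close>)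
  have FV: "sat (env (join_tuple U V) (join_tuple U' V')) p =
      sat (env (join_tuple W Z) (join_tuple W' Z')) p"
    if "{U, V, U', V', W, Z, W', Z'} \<subseteq> tuples n" "p \<in> {\<delta>, \<epsilon>, \<rho>}"
      "tp U U' = tp W W'" "tp V V' = tp Z Z'" for U V U' V' W Z W' Z' p
  proof -
    have "agree \<Phi> (env U U') (env W W')" "agree \<Phi> (env V V') (env Z Z')"
      using that(3,4) by (auto simp: agree_def tp_def)
    then have "agree (F p) (env U U') (env W W')" "agree (F p) (env V V') (env Z Z')"
      using that(2) by (auto simp: agree_def \<Phi>_def)
    from F(2)[OF this] that(1) show ?thesis by (simp add: env_join_tuple[where n = n])
  qed
  have swap: "sat (env (join_tuple U V) (join_tuple U' V')) p =
      sat (env (join_tuple V U) (join_tuple V' U')) p"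
    if "{U, V, U', V'} \<subseteq> tuples n" for U V U' V' p
    using that by (simp add: env_join_tuple[where n = n] sat_joins_commute[of "env U U'"])

  have D_swap: "join_tuple V U \<in> D" if "{U, V} \<subseteq> tuples n" "join_tuple U V \<in> D" for U V
  proof -
    have "sat (env (join_tuple V U) (join_tuple V U)) \<delta>"
      using that swap[of U V U V \<delta>] D_iff by simp
    with that show ?thesis using D_iff join_tuple_in_tuples by simp
  qed
  have symmetric: "(X, Y) \<in> E" if "X \<in> D" "Y \<in> D" "sat (env X Y) \<rho> = sat (env Y X) \<rho>" for X Y
    by (rule eq_classes_if_symmetric[OF equiv resp lin]) (use that R_iff in simp_all)
  \<comment> \<open>Exchanging factors turns this pair of joins into the reversed pair, so
    \<open>\<rho>\<close> cannot tell the two directions apart.\<close>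
  have E_swap: "(join_tuple U V, join_tuple V U) \<in> E"
    if "{U, V} \<subseteq> tuples n" "join_tuple U V \<in> D" for U V
  proof (rule symmetric)
    show "join_tuple V U \<in> D" using that by (rule D_swap)
    show "sat (env (join_tuple U V) (join_tuple V U)) \<rho> =
        sat (env (join_tuple V U) (join_tuple U V)) \<rho>"
      by (rule swap) (use that in simp)
  qed (rule that)

  define c where "c X = E `` {X}" for X
  have c_eq_iff: "c X = c Y \<longleftrightarrow> (X, Y) \<in> E" if "X \<in> D" "Y \<in> D" for X Y
    using that equiv by (simp add: c_def eq_equiv_class_iff)

  have fixed: "finite (c ` join_tuple U ` B)"
    if U: "U \<in> tuples n" and B: "B \<subseteq> tuples n" and BD: "join_tuple U ` B \<subseteq> D" for U B
  proof (rule ccontr)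
    assume "infinite (c ` join_tuple U ` B)"
    then have "infinite ((\<lambda>V. c (join_tuple U V)) ` B)" by (simp add: image_image)
    then obtain V where V: "V \<in> B"
      "infinite ((\<lambda>V. c (join_tuple U V)) ` {V' \<in> B. (tp U V', tp V' U) = (tp U V, tp V U)})"
      by (rule infinite_image_same_type[where t = "\<lambda>V. (tp U V, tp V U)"])
        (rule finite_subset[OF image_mono[OF subset_UNIV] finite_tp])
    have "c (join_tuple U V') = c (join_tuple U V)"
      if V': "V' \<in> B" "tp U V' = tp U V" "tp V' U = tp V U" for V'
    proof -
      have tup: "{U, V, V'} \<subseteq> tuples n" using U B V(1) V'(1) by auto
      have inD: "join_tuple U V \<in> D" "join_tuple U V' \<in> D" "join_tuple V' U \<in> D"
        using BD V(1) V'(1) tup D_swap[of U V'] by auto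
      \<comment> \<open>The first factors give the pairs \<open>(U, V')\<close> and
        \<open>(U, V)\<close>, the second factors \<open>(V, U)\<close> and \<open>(V', U)\<close>;
        both types match by the choice of \<open>V'\<close>. Exchanging factors then reverses the
        original pair.\<close>
      have "sat (env (join_tuple U V) (join_tuple V' U)) \<rho> =
          sat (env (join_tuple U V') (join_tuple V U)) \<rho>"
        by (rule FV) (use tup V' in auto)
      also have "\<dots> = sat (env (join_tuple V' U) (join_tuple U V)) \<rho>"
        by (rule swap) (use tup in auto)
      finally have "c (join_tuple U V) = c (join_tuple V' U)"
        using inD by (simp add: c_eq_iff symmetric)
      also have "\<dots> = c (join_tuple U V')"
        using E_swap[of V' U] tup inD by (simp add: c_eq_iff)
      finally show ?thesis by simp
    qed
    then have "(\<lambda>V. c (join_tuple U V)) ` {V' \<in> B. (tp U V', tp V' U) = (tp U V, tp V U)}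
        \<subseteq> {c (join_tuple U V)}" by auto
    with V(2) show False using finite_subset by blast
  qed

  define P where "P = {(U, V). U \<in> tuples n \<and> V \<in> tuples n \<and> join_tuple U V \<in> D}"
  define J where "J = (\<lambda>(U, V). c (join_tuple U V))"
  have "D // E \<subseteq> J ` P"
  proof
    fix x assume "x \<in> D // E"
    then obtain X where X: "X \<in> D" "x = c X" by (auto simp: c_def elim: quotientE)
    then obtain U V where "U \<in> tuples n" "V \<in> tuples n" "X = join_tuple U V"
      using D_tuples ex_join_tuple by blast
    with X show "x \<in> J ` P" by (auto simp: P_def J_def intro!: image_eqI[of _ _ "(U, V)"])
  qed
  with inf have "infinite (J ` P)" using finite_subset by blast
  then obtain UV where UV: "UV \<in> P"
    "infinite (J ` {y \<in> P. (tp (fst y) (fst y), tp (snd y) (snd y)) =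
      (tp (fst UV) (fst UV), tp (snd UV) (snd UV))})"
    by (rule infinite_image_same_type[where t = "\<lambda>y. (tp (fst y) (fst y), tp (snd y) (snd y))"])
      (rule finite_subset[OF image_mono[OF subset_UNIV] finite_tp])
  obtain U0 V0 where UV_eq: "UV = (U0, V0)" by fastforce
  \<comment> \<open>Membership of a join in \<open>D\<close> depends only on the types of
    \<open>(U, U)\<close> and \<open>(V, V)\<close>. Fixing both gives a full rectangle
    \<open>A \<times> B\<close> whose joins all lie in \<open>D\<close>.\<close>
  define A where "A = {U \<in> tuples n. tp U U = tp U0 U0}"
  define B where "B = {V \<in> tuples n. tp V V = tp V0 V0}"
  have U0: "U0 \<in> A" and V0: "V0 \<in> B" and D0: "join_tuple U0 V0 \<in> D"
    using UV(1) by (auto simp: UV_eq P_def A_def B_def)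
  have tup: "A \<subseteq> tuples n" "B \<subseteq> tuples n" by (auto simp: A_def B_def)
  have inD: "join_tuple U V \<in> D" if "U \<in> A" "V \<in> B" for U V
  proof -
    have "sat (env (join_tuple U V) (join_tuple U V)) \<delta> =
        sat (env (join_tuple U0 V0) (join_tuple U0 V0)) \<delta>"
      by (rule FV) (use that U0 V0 in \<open>auto simp: A_def B_def\<close>)
    with D0 D_iff show ?thesis using that tup join_tuple_in_tuples by blast
  qed
  \<comment> \<open>By \<open>FV\<close>, equivalence of two joins with common first factor
    \<open>U\<close> depends on \<open>U\<close> only through the type of \<open>(U, U)\<close>, so
    \<open>U0\<close> may stand in for \<open>U\<close>. The fact \<open>right\<close> is the mirror
    image, with \<open>V0\<close>.\<close>
  have left: "c (join_tuple U V) = c (join_tuple U V')"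
    if "U \<in> A" "V \<in> B" "V' \<in> B" "c (join_tuple U0 V) = c (join_tuple U0 V')" for U V V'
  proof -
    have "sat (env (join_tuple U V) (join_tuple U V')) \<epsilon> =
        sat (env (join_tuple U0 V) (join_tuple U0 V')) \<epsilon>"
      by (rule FV) (use that U0 in \<open>auto simp: A_def B_def\<close>)
    with that U0 show ?thesis by (simp add: c_eq_iff E_iff inD)
  qed
  have right: "c (join_tuple U V) = c (join_tuple U' V)"
    if "U \<in> A" "U' \<in> A" "V \<in> B" "c (join_tuple U V0) = c (join_tuple U' V0)" for U U' V
  proof -
    have "sat (env (join_tuple U V) (join_tuple U' V)) \<epsilon> =
        sat (env (join_tuple U V0) (join_tuple U' V0)) \<epsilon>"
      by (rule FV) (use that V0 in \<open>auto simp: A_def B_def\<close>)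
    with that V0 show ?thesis by (simp add: c_eq_iff E_iff inD)
  qed

  have "finite (c ` join_tuple U0 ` B)"
    using fixed[of U0 B] U0 tup inD by blast
  \<comment> \<open>\<open>fixed\<close> treats a constant first factor; \<open>E_swap\<close> moves
    the constant second factor \<open>V0\<close> to the front.\<close>
  moreover have "finite (c ` (\<lambda>U. join_tuple U V0) ` A)"
  proof -
    have "c (join_tuple U V0) = c (join_tuple V0 U)" if "U \<in> A" for U
    proof -
      have "{U, V0} \<subseteq> tuples n" using that V0 tup by auto
      then show ?thesis using E_swap D_swap inD[OF that V0] by (simp add: c_eq_iff)
    qed
    then have "c ` (\<lambda>U. join_tuple U V0) ` A = c ` join_tuple V0 ` A"
      by (simp add: image_image)
    moreover have "join_tuple V0 ` A \<subseteq> D"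
    proof
      fix X assume "X \<in> join_tuple V0 ` A"
      then obtain U where "U \<in> A" "X = join_tuple V0 U" by blast
      then show "X \<in> D" using D_swap[of U V0] inD[of U V0] V0 tup by blast
    qed
    ultimately show ?thesis using fixed[of V0 A] V0 tup by auto
  qed
  ultimately have "finite ((c ` (\<lambda>U. join_tuple U V0) ` A) \<times> (c ` join_tuple U0 ` B))"
    by simp
  \<comment> \<open>\<open>K\<close> takes finitely many values on the rectangle and, by
    \<open>left\<close> and \<open>right\<close>, determines the class of the join. The infinitely
    many classes met there are thus impossible.\<close>
  moreover define K where "K = (\<lambda>(U, V). (c (join_tuple U V0), c (join_tuple U0 V)))"
  ultimately have finite_K: "finite (K ` (A \<times> B))" by (auto elim: rev_finite_subset)
  have "infinite (J ` (A \<times> B))"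
    by (rule infinite_super[OF image_mono UV(2)]) (auto simp: P_def A_def B_def UV_eq)
  from this finite_K obtain x where
    x: "x \<in> A \<times> B" "infinite (J ` {y \<in> A \<times> B. K y = K x})"
    by (rule infinite_image_same_type)
  have "J y = J x" if "y \<in> A \<times> B" "K y = K x" for y
  proof -
    obtain U V U' V' where xy: "x = (U, V)" "y = (U', V')" by fastforce
    have "c (join_tuple U' V') = c (join_tuple U' V)"
      by (rule left) (use that x(1) xy in \<open>auto simp: K_def\<close>)
    also have "\<dots> = c (join_tuple U V)"
      by (rule right) (use that x(1) xy in \<open>auto simp: K_def\<close>)
    finally show ?thesis by (simp add: J_def xy)
  qed
  then have "J ` {y \<in> A \<times> B. K y = K x} \<subseteq> {J x}" by blast
  with x(2) show False using finite_subset by blast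
qed

end
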